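(* Let $d,n,k\ge 1$. The group $\mathrm{OB}(\mathbb{Z}^d,n,k)$ of oblivious Turing machines is finitely generated.
   Context: Let $\Sigma=\{0,\dots,n-1\}$ (tape symbols), $Q=\{1,\dots,k\}$ (states). The shift on $\Sigma^{\mathbb{Z}^d}$ is $(\sigma^{v}(x))_{u}=x_{u-v}$. A moving head $(\mathbb{Z}^d,n,k)$-Turing machine is a map $T:\Sigma^{\mathbb{Z}^d}\times Q\times\mathbb{Z}^d\to\Sigma^{\mathbb{Z}^d}\times Q\times\mathbb{Z}^d$ (a triple is tape, state, head position) for which there are finite sets $F_{\rm in},F_{\rm out}\subset\mathbb{Z}^d$ and a function (local rule) $f:\Sigma^{F_{\rm in}}\times Q\to\Sigma^{F_{\rm out}}\times Q\times\mathbb{Z}^d$ such that $T(x,q,v)=(\tilde x,\tilde q,v+\tilde u)$, where $(\tilde p,\tilde q,\tilde u)=f(\sigma^{-v}(x)|_{F_{\rm in}},q)$, and $\tilde x_{u}=\tilde p_{u-v}$ if $u-v\in F_{\rm out}$, $\tilde x_u=x_u$ otherwise. $T$ is reversible if there is a $(\mathbb{Z}^d,n,k)$-Turing machine $T^{-1}$ with $T\circ T^{-1}=T^{-1}\circ T=\mathrm{id}$. $\mathrm{RTM}(\mathbb{Z}^d,n,k)$ is the group of reversible machines under composition. $\mathrm{LP}(\mathbb{Z}^d,n,k)$ (local permutations) is the subgroup of reversible machines that never move the head (the $\mathbb{Z}^d$-component of the local rule is always $0$). For $w\in\mathbb{Z}^d$ let $T_w(x,q,v)=(x,q,v+w)$,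 and let $\mathrm{SHIFT}(\mathbb{Z}^d,n,k)=\langle\{T_w\}_{w\in\mathbb{Z}^d}\rangle$. Then $\mathrm{OB}(\mathbb{Z}^d,n,k)=\langle\mathrm{SHIFT}(\mathbb{Z}^d,n,k),\mathrm{LP}(\mathbb{Z}^d,n,k)\rangle$. *)

theory Defs
  imports "HOL-Analysis.Finite_Cartesian_Product" "HOL-Algebra.Generated_Groups"
begin

text \<open>
  The parameters \<open>d, n, k \<ge> 1\<close> are carried by the finite (hence nonempty) types
  \<open>'d\<close>, \<open>'a\<close>, \<open>'q\<close>: the grid is \<open>int^'d\<close> with \<open>d = CARD('d)\<close>, the tape alphabet is \<open>'a\<close>
  with \<open>n = CARD('a)\<close>, and the state set is \<open>'q\<close> with \<open>k = CARD('q)\<close>.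
\<close>

type_synonym ('d, 'a) tape = "int^'d \<Rightarrow> 'a"
type_synonym ('d, 'a, 'q) config = "('d, 'a) tape \<times> 'q \<times> (int^'d)"
type_synonym ('d, 'a, 'q) machine = "('d, 'a, 'q) config \<Rightarrow> ('d, 'a, 'q) config"

text \<open>
  A pattern, i.e. an element of \<open>\<Sigma>\<^sup>F\<close>, is an extensional function in \<open>F \<rightarrow>\<^sub>E UNIV\<close>; the values
  of a local rule on arguments that are not patterns are irrelevant.
\<close>

type_synonym ('d, 'a, 'q) local_rule =
  "('d, 'a) tape \<Rightarrow> 'q \<Rightarrow> ('d, 'a) tape \<times> 'q \<times> (int^'d)"

definition shift :: "int^'d \<Rightarrow> ('d, 'a) tape \<Rightarrow> ('d, 'a) tape"
  where "shift v x = (\<lambda>u. x (u - v))"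

definition has_local_rule ::
  "('d::finite, 'a::finite, 'q::finite) machine \<Rightarrow> (int^'d) set \<Rightarrow> (int^'d) set
     \<Rightarrow> ('d, 'a, 'q) local_rule \<Rightarrow> bool"
  where "has_local_rule T F_in F_out f \<longleftrightarrow>
    finite F_in \<and> finite F_out \<and>
    (\<forall>p \<in> F_in \<rightarrow>\<^sub>E UNIV. \<forall>q. fst (f p q) \<in> F_out \<rightarrow>\<^sub>E UNIV) \<and>
    (\<forall>x q v. T (x, q, v) =
      (let (p', q', u') = f (restrict (shift (- v) x) F_in) q
       in (\<lambda>u. if u - v \<in> F_out then p' (u - v) else x u, q', v + u')))"

definition turing_machine :: "('d::finite, 'a::finite, 'q::finite) machine \<Rightarrow> bool"
  where "turing_machine T \<longleftrightarrow> (\<exists>F_in F_out f. has_local_rule T F_in F_out f)"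

definition reversible :: "('d::finite, 'a::finite, 'q::finite) machine \<Rightarrow> bool"
  where "reversible T \<longleftrightarrow>
    turing_machine T \<and> (\<exists>T'. turing_machine T' \<and> T \<circ> T' = id \<and> T' \<circ> T = id)"

definition RTM :: "('d::finite, 'a::finite, 'q::finite) machine monoid"
  where "RTM = \<lparr>carrier = {T. reversible T}, mult = (\<circ>), one = id\<rparr>"

definition LP :: "('d::finite, 'a::finite, 'q::finite) machine set"
  where "LP = {T. reversible T \<and>
    (\<exists>F_in F_out f. has_local_rule T F_in F_out f \<and>
      (\<forall>p \<in> F_in \<rightarrow>\<^sub>E UNIV. \<forall>q. snd (snd (f p q)) = 0))}"

definition head_shift :: "int^'d \<Rightarrow> ('d::finite, 'a::finite, 'q::finite) machine"
  where "head_shift w = (\<lambda>(x, q, v). (x, q, v + w))"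

definition SHIFT :: "('d::finite, 'a::finite, 'q::finite) machine set"
  where "SHIFT = generate RTM (range head_shift)"

definition OB :: "('d::finite, 'a::finite, 'q::finite) machine monoid"
  where "OB = RTM\<lparr>carrier := generate RTM (SHIFT \<union> LP)\<rparr>"

definition finitely_generated_group :: "('g, 'r) monoid_scheme \<Rightarrow> bool"
  where "finitely_generated_group G \<longleftrightarrow>
    group G \<and> (\<exists>S. finite S \<and> S \<subseteq> carrier G \<and> generate G S = carrier G)"

end

theory Submission
  imports Defs "HOL-Combinatorics.Permutations"
begin

text \<open>
  The group is generated by the unit shifts together with the finitely many machines in \<open>LP\<close> that
  act on one fixed finite set \<open>F0\<close> of cells around the head. Since a machine in \<open>LP\<close> applies one
  and the same bijection of tape and state (a gate) relative to its head (\<open>LP_imp_at_head\<close>), what has to be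
  shown is that the gates available from these generators include the gates on every finite set of
  cells.

  Conjugating by shifts translates gates (\<open>head_shift_conj_cell_swap\<close>). So all swaps of neighbouring
  cells are available, hence all swaps of two cells, and every gate on at most four cells,
  wherever they are, is conjugate by swaps to one on \<open>F0\<close> (\<open>acts_on_relocate\<close>).

  Gates on four cells generate all gates. A commutator of two controlled permutations is the
  commutator of the permutations, controlled by both conditions, and for an alphabet with at least two
  letters a 3-cycle of patterns on three cells is a commutator of 3-cycles; so controls can be added one by
  one (\<open>controlled_three_cycle\<close>). The resulting 3-cycles follow paths in the connected graph
  of patterns that differ in at most one cell, and hence produce every product of two transpositions of patterns
  on a given set of cells (\<open>lift_transposition_pair\<close>).

  What remains is a question of parity, and it depends on the alphabet (\<open>lift_transposition\<close>). If its
  size is even, every gate becomes an even permutation when it is viewed on one more cell. If its size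
  is odd, parity does not change when cells are added, so a transposition on four cells supplies
  an odd permutation on any larger set.
\<close>

section \<open>Gates on finitely many cells\<close>

type_synonym ('c, 'a, 'q) gate = "('c \<Rightarrow> 'a) \<times> 'q \<Rightarrow> ('c \<Rightarrow> 'a) \<times> 'q"

text \<open>
  What a machine that does not move does in one step, seen from its head, is a bijection of
  tape and state that rewrites a finite set \<open>F\<close> of cells and the state, and looks at nothing
  else. The predicate is stated without choosing a local rule, so that it is visibly monotone in
  \<open>F\<close> and stable under renaming cells.
\<close>

definition acts_on :: "'c set \<Rightarrow> ('c, 'a, 'q) gate \<Rightarrow> bool"
  where "acts_on F g \<longleftrightarrow> bij g \<and>
    (\<forall>x q. \<forall>u. u \<notin> F \<longrightarrow> fst (g (x, q)) u = x u) \<and>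
    (\<forall>x y q. (\<forall>u\<in>F. x u = y u) \<longrightarrow>
      snd (g (x, q)) = snd (g (y, q)) \<and> (\<forall>u\<in>F. fst (g (x, q)) u = fst (g (y, q)) u))"

text \<open>
  The tape parts are extensional, so that for finite \<open>F\<close> this is a finite set and the gates on
  \<open>F\<close> correspond exactly to its permutations.
\<close>

definition patterns :: "'c set \<Rightarrow> (('c \<Rightarrow> 'a) \<times> 'q) set"
  where "patterns F = (F \<rightarrow>\<^sub>E UNIV) \<times> UNIV"

definition window :: "'c set \<Rightarrow> ('c \<Rightarrow> 'a) \<times> 'q \<Rightarrow> ('c \<Rightarrow> 'a) \<times> 'q"
  where "window F y = (restrict (fst y) F, snd y)"

definition lift :: "'c set \<Rightarrow> ('c, 'a, 'q) gate \<Rightarrow> ('c, 'a, 'q) gate"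
  where "lift F g y = (override_on (fst y) (fst (g (window F y))) F, snd (g (window F y)))"

text \<open>
  The controlled gate of circuit theory: it fires only on tapes that satisfy \<open>P\<close>. In all uses
  \<open>P\<close> looks at cells that \<open>g\<close> does not rewrite.
\<close>

definition ctrl :: "(('c \<Rightarrow> 'a) \<Rightarrow> bool) \<Rightarrow> ('c, 'a, 'q) gate \<Rightarrow> ('c, 'a, 'q) gate"
  where "ctrl P g y = (if P (fst y) then g y else y)"

definition three_cycle :: "'y \<Rightarrow> 'y \<Rightarrow> 'y \<Rightarrow> 'y \<Rightarrow> 'y"
  where "three_cycle x y z = transpose x y \<circ> transpose y z"

lemma window_in_patterns [simp]: "window F y \<in> patterns F"
  by (auto simp: window_def patterns_def)

lemma window_pattern [simp]: "p \<in> patterns F \<Longrightarrow> window F p = p"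
  by (auto simp: window_def patterns_def PiE_restrict)

lemma window_lift: "g \<in> patterns F \<rightarrow> patterns F \<Longrightarrow> window F (lift F g y) = g (window F y)"
proof -
  assume "g \<in> patterns F \<rightarrow> patterns F"
  then have "g (window F y) \<in> patterns F" by auto
  then show ?thesis
    unfolding lift_def
    by (auto simp: window_def patterns_def prod_eq_iff override_on_def restrict_def PiE_def extensional_def)
qed

lemma lift_comp: "h \<in> patterns F \<rightarrow> patterns F \<Longrightarrow> lift F g \<circ> lift F h = lift F (g \<circ> h)"
  by (rule ext) (simp add: lift_def[of F g] lift_def[of F "g \<circ> h"] window_lift,
      simp add: lift_def override_on_def fun_eq_iff)

lemma lift_id [simp]: "lift F id = id"
  by (rule ext) (auto simp: lift_def window_def override_on_def prod_eq_iff)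

lemma permutes_Pi: "g permutes A \<Longrightarrow> g \<in> A \<rightarrow> A"
  by (auto simp: permutes_in_image)

lemma transpose_Pi: "x \<in> A \<Longrightarrow> y \<in> A \<Longrightarrow> transpose x y \<in> A \<rightarrow> A"
  by (auto simp: transpose_def)

lemma finite_patterns [simp]: "finite F \<Longrightarrow> finite (patterns F :: (('c \<Rightarrow> 'a::finite) \<times> 'q::finite) set)"
  unfolding patterns_def by (simp add: finite_PiE)

lemma card_patterns:
  "finite F \<Longrightarrow> card (patterns F :: (('c \<Rightarrow> 'a::finite) \<times> 'q::finite) set) = CARD('a) ^ card F * CARD('q)"
  by (simp add: patterns_def card_cartesian_product card_PiE)

lemma acts_on_lift: "g permutes patterns F \<Longrightarrow> acts_on F (lift F g)"
proof -
  assume g: "g permutes patterns F"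
  have "lift F g \<circ> lift F (Hilbert_Choice.inv g) = id" "lift F (Hilbert_Choice.inv g) \<circ> lift F g = id"
    using g by (simp_all add: lift_comp permutes_Pi permutes_inv permutes_inv_o)
  then have "bij (lift F g)" using o_bij by blast
  moreover have "window F (x, q) = window F (y, q)" if "\<forall>u\<in>F. x u = y u" for x y :: "'a \<Rightarrow> 'b" and q :: 'c
    using that by (auto simp: window_def)
  ultimately show ?thesis
    by (fastforce simp: acts_on_def lift_def override_on_def)
qed

lemma acts_on_agree:
  assumes "acts_on F g" "\<forall>u\<in>F. x u = y u"
  shows "snd (g (x, q)) = snd (g (y, q))" "u \<in> F \<Longrightarrow> fst (g (x, q)) u = fst (g (y, q)) u"
  using assms unfolding acts_on_def by blast+

lemma acts_on_outside: "acts_on F g \<Longrightarrow> u \<notin> F \<Longrightarrow> fst (g y) u = fst y u"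
  unfolding acts_on_def by (cases y) auto

text \<open>
  A gate on \<open>F\<close> maps patterns on \<open>F\<close> to patterns on \<open>F\<close>, because cells outside \<open>F\<close> keep
  the value \<open>undefined\<close>; being injective on a finite set, it permutes them. This turns every
  question about gates on \<open>F\<close> into one about permutations of a finite set.
\<close>

lemma acts_on_imp_lift:
  fixes h :: "('c, 'a::finite, 'q::finite) gate"
  assumes "acts_on F h" and "finite F"
  obtains g where "g permutes patterns F" and "h = lift F g"
proof -
  define g where "g = (\<lambda>p. if p \<in> patterns F then h p else p)"
  have into: "h p \<in> patterns F" if "p \<in> patterns F" for p
    using that acts_on_outside[OF assms(1), of _ p]
    by (cases "h p"; cases p) (auto simp: patterns_def PiE_def extensional_def)
  have inj: "inj h" using assms(1) by (auto simp: acts_on_def bij_def)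
  have "inj_on g (patterns F)" unfolding g_def inj_on_def using inj by (auto simp: inj_eq)
  moreover have "g ` patterns F \<subseteq> patterns F" using into by (auto simp: g_def)
  ultimately have "bij_betw g (patterns F) (patterns F)"
    using assms(2) by (simp add: bij_betw_def endo_inj_surj)
  then have perm: "g permutes patterns F"
    by (rule bij_imp_permutes) (simp add: g_def)
  have "h y = lift F g y" for y
  proof -
    obtain x q where y: "y = (x, q)" by (cases y)
    have ag: "\<forall>u\<in>F. x u = restrict x F u" by simp
    have "snd (h y) = snd (h (window F y))"
      using acts_on_agree(1)[OF assms(1) ag, of q] by (simp add: y window_def restrict_def)
    moreover have "fst (h y) u = override_on x (fst (h (window F y))) F u" for u
      using acts_on_agree(2)[OF assms(1) ag, of u q] acts_on_outside[OF assms(1), of u y]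
      by (simp add: y window_def override_on_def restrict_def)
    ultimately show ?thesis
      by (simp add: lift_def g_def prod_eq_iff y fun_eq_iff)
  qed
  then have "h = lift F g" by blast
  with perm that show thesis by blast
qed

lemma acts_on_mono:
  assumes g: "acts_on F g" and sub: "F \<subseteq> F'"
  shows "acts_on F' g"
  unfolding acts_on_def
proof (intro conjI allI impI ballI)
  show "bij g" using g by (simp add: acts_on_def)
next
  fix x q u assume "u \<notin> F'"
  then show "fst (g (x, q)) u = x u" using acts_on_outside[OF g, of u "(x, q)"] sub by auto
next
  fix x y :: "'a \<Rightarrow> 'b" and q :: 'c assume ag: "\<forall>u\<in>F'. x u = y u"
  then have agF: "\<forall>u\<in>F. x u = y u" using sub by blast
  show "snd (g (x, q)) = snd (g (y, q))" using acts_on_agree(1)[OF g agF] .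
  fix u assume "u \<in> F'"
  then show "fst (g (x, q)) u = fst (g (y, q)) u"
    using ag acts_on_agree(2)[OF g agF, of u q] acts_on_outside[OF g, of u] by (cases "u \<in> F") auto
qed

lemma acts_on_inv:
  fixes h :: "('c, 'a::finite, 'q::finite) gate"
  assumes "acts_on F h" "finite F"
  shows "acts_on F (Hilbert_Choice.inv h)"
proof -
  obtain g where g: "g permutes patterns F" "h = lift F g" using acts_on_imp_lift[OF assms] .
  have "lift F g \<circ> lift F (Hilbert_Choice.inv g) = id" "lift F (Hilbert_Choice.inv g) \<circ> lift F g = id"
    using g by (simp_all add: lift_comp permutes_Pi permutes_inv permutes_inv_o)
  then have "Hilbert_Choice.inv h = lift F (Hilbert_Choice.inv g)" unfolding g by (metis inv_unique_comp)
  then show ?thesis using acts_on_lift permutes_inv g by metis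
qed

lemma finite_acts_on:
  "finite F \<Longrightarrow> finite {g :: ('c, 'a::finite, 'q::finite) gate. acts_on F g}"
proof -
  assume F: "finite F"
  have "{g :: ('c, 'a, 'q) gate. acts_on F g} \<subseteq> lift F ` {g. g permutes patterns F}"
    using acts_on_imp_lift[OF _ F] by blast
  then show ?thesis using finite_permutations[OF finite_patterns[OF F]] finite_surj by blast
qed

lemma acts_on_id: "acts_on F id"
  by (simp add: acts_on_def)

section \<open>Controlled gates and commutators\<close>

lemma three_cycle_permutes: "x \<in> A \<Longrightarrow> y \<in> A \<Longrightarrow> z \<in> A \<Longrightarrow> three_cycle x y z permutes A"
  unfolding three_cycle_def by (intro permutes_compose permutes_swap_id)

lemma three_cycle_inverse: "three_cycle x y z \<circ> three_cycle z y x = id"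
  by (auto simp: three_cycle_def transpose_def fun_eq_iff)

lemma three_cycle_apply:
  assumes "x \<noteq> y" "y \<noteq> z" "x \<noteq> z"
  shows "three_cycle x y z p = (if p = x then y else if p = y then z else if p = z then x else p)"
  using assms by (auto simp: three_cycle_def transpose_def)

text \<open>
  The commutator of two permutations whose supports share the single point \<open>x\<close> is a 3-cycle. Two
  auxiliary points \<open>v\<close> and \<open>w\<close> allow both factors to be 3-cycles themselves.
\<close>

lemma three_cycle_commutator:
  assumes "distinct [x, y, z, v, w]"
  shows "three_cycle x y z =
    three_cycle x y v \<circ> three_cycle x z w \<circ> three_cycle v y x \<circ> three_cycle w z x"
proof
  fix p
  have ne: "x \<noteq> y" "x \<noteq> z" "x \<noteq> v" "x \<noteq> w" "y \<noteq> z" "y \<noteq> v" "y \<noteq> w" "z \<noteq> v" "z \<noteq> w" "v \<noteq> w"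
    using assms by auto
  note rules = three_cycle_apply ne ne[symmetric]
  consider "p = x" | "p = y" | "p = z" | "p = v" | "p = w"
    | "p \<noteq> x" "p \<noteq> y" "p \<noteq> z" "p \<noteq> v" "p \<noteq> w" by blast
  then show "three_cycle x y z p =
    (three_cycle x y v \<circ> three_cycle x z w \<circ> three_cycle v y x \<circ> three_cycle w z x) p"
    by cases (simp_all add: rules)
qed

lemma ctrl_comp:
  assumes "\<And>y. P (fst (h y)) = P (fst y)"
  shows "ctrl P g \<circ> ctrl P h = ctrl P (g \<circ> h)"
  using assms by (auto simp: ctrl_def fun_eq_iff)

text \<open>
  If only one of the two conditions holds, only one pair of mutually inverse factors fires and the
  product collapses to the identity. Taking commutators thus forms conjunctions of conditions, which
  is how few-cell gates build gates with arbitrarily many controls.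
\<close>

lemma ctrl_commutator:
  assumes "U \<circ> U' = id" "V \<circ> V' = id"
    and "\<And>y. P (fst (V y)) = P (fst y)" "\<And>y. P (fst (V' y)) = P (fst y)" "\<And>y. P (fst (U' y)) = P (fst y)"
    and "\<And>y. Q (fst (U y)) = Q (fst y)" "\<And>y. Q (fst (U' y)) = Q (fst y)" "\<And>y. Q (fst (V' y)) = Q (fst y)"
  shows "ctrl P U \<circ> ctrl Q V \<circ> ctrl P U' \<circ> ctrl Q V' = ctrl (\<lambda>x. P x \<and> Q x) (U \<circ> V \<circ> U' \<circ> V')"
proof
  fix y
  have "U (U' y) = y" "V (V' y) = y" using assms(1,2) by (metis comp_apply id_apply)+
  then show "(ctrl P U \<circ> ctrl Q V \<circ> ctrl P U' \<circ> ctrl Q V') y =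
      ctrl (\<lambda>x. P x \<and> Q x) (U \<circ> V \<circ> U' \<circ> V') y"
    using assms(3-8) by (simp add: ctrl_def)
qed

lemma acts_on_preserves_disjoint:
  assumes "acts_on R g" "C \<inter> R = {}" "\<And>x y. (\<forall>c\<in>C. x c = y c) \<Longrightarrow> P x = P y"
  shows "P (fst (g y)) = P (fst y)"
  by (rule assms(3)) (use assms(1,2) in \<open>auto intro: acts_on_outside\<close>)

lemma acts_on_ctrl:
  assumes g: "acts_on R g" and dis: "C \<inter> R = {}"
    and P: "\<And>x y. (\<forall>c\<in>C. x c = y c) \<Longrightarrow> P x = P y"
  shows "acts_on (R \<union> C) (ctrl P g)"
proof -
  have b: "bij g" using g by (simp add: acts_on_def)
  have pr: "P (fst (g y)) = P (fst y)" for y by (rule acts_on_preserves_disjoint[OF g dis P])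
  have pr': "P (fst (Hilbert_Choice.inv g y)) = P (fst y)" for y using pr[of "Hilbert_Choice.inv g y"] b by (simp add: bij_is_surj surj_f_inv_f)
  have "g \<circ> Hilbert_Choice.inv g = id" "Hilbert_Choice.inv g \<circ> g = id"
    using b by (simp_all add: bij_is_surj bij_is_inj surj_iff[symmetric])
  then have "ctrl P g \<circ> ctrl P (Hilbert_Choice.inv g) = id" "ctrl P (Hilbert_Choice.inv g) \<circ> ctrl P g = id"
    using pr pr' by (simp_all add: ctrl_comp) (auto simp: ctrl_def)
  then have bij: "bij (ctrl P g)" using o_bij by blast
  show ?thesis unfolding acts_on_def
  proof (intro conjI allI impI bij)
    fix x q u assume "u \<notin> R \<union> C"
    then show "fst (ctrl P g (x, q)) u = x u"
      using acts_on_outside[OF g] by (auto simp: ctrl_def)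
  next
    fix x y :: "'a \<Rightarrow> 'b" and q :: 'c assume ag: "\<forall>u\<in>R \<union> C. x u = y u"
    then have Pxy: "P x = P y" using P by blast
    have agR: "\<forall>u\<in>R. x u = y u" using ag by blast
    show "snd (ctrl P g (x, q)) = snd (ctrl P g (y, q))"
      using Pxy acts_on_agree(1)[OF g agR] by (simp add: ctrl_def)
    show "\<forall>u\<in>R \<union> C. fst (ctrl P g (x, q)) u = fst (ctrl P g (y, q)) u"
    proof
      fix u assume u: "u \<in> R \<union> C"
      show "fst (ctrl P g (x, q)) u = fst (ctrl P g (y, q)) u"
        using u ag Pxy acts_on_agree(2)[OF g agR, of u q] acts_on_outside[OF g, of u]
        by (cases "u \<in> R") (simp_all add: ctrl_def)
    qed
  qed
qed

text \<open>
  A transposition of two patterns that agree outside \<open>R\<close> is a transposition on \<open>R\<close>, controlled by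
  their common values on the remaining cells.
\<close>

lemma lift_transpose_eq_ctrl:
  assumes "R \<subseteq> F" and p: "p \<in> patterns F" "p' \<in> patterns F"
    and ag: "\<And>u. u \<in> F - R \<Longrightarrow> fst p u = fst p' u"
  shows "lift F (transpose p p') =
    ctrl (\<lambda>x. \<forall>u\<in>F - R. x u = fst p u) (lift R (transpose (window R p) (window R p')))"
proof
  fix y :: "('a \<Rightarrow> 'b) \<times> 'c"
  have w: "window F y = r \<longleftrightarrow> window R y = window R r \<and> (\<forall>u\<in>F - R. fst y u = fst r u)"
    if "r \<in> patterns F" for r
  proof -
    have "window F y = r \<longleftrightarrow> (\<forall>u\<in>F. fst y u = fst r u) \<and> snd y = snd r"
      using that by (cases r) (auto simp: window_def patterns_def prod_eq_iff PiE_def extensional_def fun_eq_iff)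
    moreover have "window R y = window R r \<longleftrightarrow> (\<forall>u\<in>R. fst y u = fst r u) \<and> snd y = snd r"
      by (auto simp: window_def prod_eq_iff fun_eq_iff restrict_def)
    ultimately show ?thesis using assms(1) by blast
  qed
  note w1 = w[OF p(1)] and w2 = w[OF p(2)]
  have ov: "override_on (fst y) (fst r) F = override_on (fst y) (fst (window R r)) R"
    if "\<forall>u\<in>F - R. fst y u = fst r u" for r :: "('a \<Rightarrow> 'b) \<times> 'c"
    using that assms(1) by (auto simp: override_on_def window_def fun_eq_iff)
  have triv: "override_on (fst y) (fst (window A y)) A = fst y" for A
    by (auto simp: override_on_def window_def fun_eq_iff)
  show "lift F (transpose p p') y =
    ctrl (\<lambda>x. \<forall>u\<in>F - R. x u = fst p u) (lift R (transpose (window R p) (window R p'))) y"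
  proof (cases "\<forall>u\<in>F - R. fst y u = fst p u")
    case agp: True
    then have agp': "\<forall>u\<in>F - R. fst y u = fst p' u" using ag by auto
    consider "window R y = window R p" | "window R y \<noteq> window R p" "window R y = window R p'"
      | "window R y \<noteq> window R p" "window R y \<noteq> window R p'" by blast
    then show ?thesis
    proof cases
      case 1
      then have "window F y = p" using w1 agp by blast
      then show ?thesis using 1 ov[OF agp'] agp by (simp add: lift_def ctrl_def) (simp add: window_def)
    next
      case 2
      then have "window F y = p'" using w2 agp' by blast
      then show ?thesis using 2 ov[OF agp] agp by (simp add: lift_def ctrl_def) (simp add: window_def)
    next
      case 3
      then have "window F y \<noteq> p" "window F y \<noteq> p'" using w1 w2 by auto
      then show ?thesis using 3 triv agp by (simp add: lift_def ctrl_def) (simp add: window_def)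
    qed
  next
    case False
    then have "window F y \<noteq> p" "window F y \<noteq> p'" using w1 w2 ag by auto
    then show ?thesis using False triv by (auto simp add: lift_def ctrl_def prod_eq_iff) (auto simp: window_def)
  qed
qed

section \<open>Products of two transpositions\<close>

text \<open>
  For a connected graph, the 3-cycles along paths of length two generate all products of two
  transpositions. The relation ``the product of the two transpositions is in \<open>K\<close>'' is transitive,
  since the middle transposition cancels; it therefore spreads from incident edges to all edges, and
  then, conjugating one edge at a time, to transpositions of arbitrary points.
\<close>

lemma transposition_pairs_from_edges:
  assumes comp: "\<And>f g. K f \<Longrightarrow> K g \<Longrightarrow> K (f \<circ> g)" and id: "K id"
    and irr: "\<And>x y. E x y \<Longrightarrow> x \<noteq> y" and sym: "\<And>x y. E x y \<Longrightarrow> E y x"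
    and path: "\<And>x y z. E x y \<Longrightarrow> E y z \<Longrightarrow> x \<noteq> z \<Longrightarrow> K (transpose x y \<circ> transpose y z)"
    and conn: "\<And>x y. x \<in> A \<Longrightarrow> y \<in> A \<Longrightarrow> E\<^sup>*\<^sup>* x y"
    and pts: "x \<in> A" "y \<in> A" "u \<in> A" "v \<in> A" "x \<noteq> y" "u \<noteq> v"
    and edge_in: "\<And>x y. E x y \<Longrightarrow> x \<in> A \<and> y \<in> A"
  shows "K (transpose x y \<circ> transpose u v)"
proof -
  \<comment> \<open>Going back along the same edge gives the identity.\<close>
  have adjacent: "K (transpose x y \<circ> transpose y z)" if "E x y" "E y z" for x y z
    using path[OF that] id by (cases "x = z") (simp_all add: transpose_commute[of z])
  have chain: "K (f \<circ> g)" if "K (f \<circ> transpose x y)" "K (transpose x y \<circ> g)" for f g x y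
  proof -
    have "(f \<circ> transpose x y) \<circ> (transpose x y \<circ> g) = f \<circ> g"
      by (simp add: fun_eq_iff)
    then show ?thesis using comp[OF that] by simp
  qed
  have edges: "K (transpose x y \<circ> transpose u v)" if e: "E x y" "E u v" for x y u v
  proof -
    have "E\<^sup>*\<^sup>* y u" using conn edge_in e by blast
    then have "\<forall>v. E u v \<longrightarrow> K (transpose x y \<circ> transpose u v)"
    proof (induction rule: rtranclp_induct)
      case base
      then show ?case using adjacent e(1) by blast
    next
      case (step u' u)
      then show ?case using chain adjacent by blast
    qed
    with e show ?thesis by blast
  qed
  have one: "K (transpose x y \<circ> transpose u v) \<and> K (transpose u v \<circ> transpose x y)"
    if xy: "x \<in> A" "y \<in> A" "x \<noteq> y" and e: "E u v" for x y u v
  proof -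
    have "E\<^sup>*\<^sup>* x y" using conn xy by blast
    then have "x \<noteq> y \<longrightarrow> (\<forall>u v. E u v \<longrightarrow>
        K (transpose x y \<circ> transpose u v) \<and> K (transpose u v \<circ> transpose x y))"
    proof (induction rule: rtranclp_induct)
      case base
      then show ?case by simp
    next
      case (step y' y)
      show ?case
      proof (intro impI allI)
        fix u v assume "x \<noteq> y" and uv: "E u v"
        show "K (transpose x y \<circ> transpose u v) \<and> K (transpose u v \<circ> transpose x y)"
        proof (cases "x = y'")
          case True
          then show ?thesis using edges step.hyps uv by blast
        next
          case False
          \<comment> \<open>The transposition of the end points of a path is that of a shorter path, conjugated by the last edge.\<close>
          let ?s = "transpose y' y" and ?t = "transpose x y'"
          have conj: "transpose x y = ?s \<circ> ?t \<circ> ?s"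
            using transpose_comp_triple[of y x y'] False \<open>x \<noteq> y\<close>
            by (simp add: transpose_commute)
          have "K (?s \<circ> ?t)" "K (?t \<circ> ?s)" using step False by blast+
          moreover have "K (?s \<circ> transpose u v)" "K (transpose u v \<circ> ?s)"
            using edges step.hyps uv by blast+
          ultimately have "K ((?s \<circ> ?t) \<circ> (?s \<circ> transpose u v))"
            and "K ((transpose u v \<circ> ?s) \<circ> (?t \<circ> ?s))" using comp by blast+
          then show ?thesis by (simp add: conj comp_assoc)
        qed
      qed
    qed
    with that show ?thesis by blast
  qed
  obtain z where "E x z" using conn[OF pts(1,2)] pts(5) by (blast elim: converse_rtranclpE)
  then show ?thesis using one pts chain by blast
qed

text \<open>
  The state may change along with the cell: then patterns that differ in at most one cell need no
  separate treatment of the state.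
\<close>

definition adjacent :: "'c set \<Rightarrow> ('c \<Rightarrow> 'a) \<times> 'q \<Rightarrow> ('c \<Rightarrow> 'a) \<times> 'q \<Rightarrow> bool"
  where "adjacent F x y \<longleftrightarrow> x \<in> patterns F \<and> y \<in> patterns F \<and> x \<noteq> y \<and>
    (\<exists>c. \<forall>u. u \<noteq> c \<longrightarrow> fst x u = fst y u)"

lemma adjacentD: "adjacent F x y \<Longrightarrow> x \<in> patterns F \<and> y \<in> patterns F \<and> x \<noteq> y"
  by (simp add: adjacent_def)

lemma adjacent_sym: "adjacent F x y \<Longrightarrow> adjacent F y x"
  unfolding adjacent_def by metis

lemma adjacent_connected:
  assumes F: "finite F" and x: "x \<in> patterns F" and y: "y \<in> patterns F"
  shows "(adjacent F)\<^sup>*\<^sup>* x y"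
proof -
  have "(adjacent F)\<^sup>*\<^sup>* x (override_on (fst x) (fst y) D, snd y)" if "finite D" "D \<subseteq> F" for D
    using that
  proof (induction D rule: finite_induct)
    case empty
    have "x = (fst x, snd y) \<or> adjacent F x (fst x, snd y)"
      using x by (auto simp: adjacent_def patterns_def)
    then show ?case by auto
  next
    case (insert c D)
    let ?z = "\<lambda>D. (override_on (fst x) (fst y) D, snd y)"
    have in_patterns: "?z D \<in> patterns F" if "D \<subseteq> F" for D
      using x y that by (auto simp: patterns_def override_on_def PiE_def extensional_def)
    have "?z D = ?z (insert c D) \<or> adjacent F (?z D) (?z (insert c D))"
    proof -
      have "\<forall>u. u \<noteq> c \<longrightarrow> fst (?z D) u = fst (?z (insert c D)) u" by (simp add: override_on_def)
      then show ?thesis using in_patterns insert.prems unfolding adjacent_def by blast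
    qed
    with insert show ?case by auto
  qed
  from this[OF F subset_refl] have "(adjacent F)\<^sup>*\<^sup>* x (override_on (fst x) (fst y) F, snd y)" .
  moreover have "override_on (fst x) (fst y) F = fst y"
    using x y by (auto simp: patterns_def override_on_def PiE_def extensional_def fun_eq_iff)
  ultimately show ?thesis by simp
qed

lemma ctrl_True [simp]: "ctrl (\<lambda>x. True) g = g"
  by (simp add: ctrl_def fun_eq_iff)

lemma lift_three_cycle:
  "x \<in> patterns F \<Longrightarrow> y \<in> patterns F \<Longrightarrow> z \<in> patterns F \<Longrightarrow>
    lift F (three_cycle x y z) = lift F (transpose x y) \<circ> lift F (transpose y z)"
  by (simp add: three_cycle_def lift_comp transpose_Pi)

lemma window_eq_iff: "window R x = window R y \<longleftrightarrow> (\<forall>u\<in>R. fst x u = fst y u) \<and> snd x = snd y"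
  by (auto simp: window_def prod_eq_iff fun_eq_iff restrict_def)

lemma acts_on_lift_three_cycle:
  "x \<in> patterns F \<Longrightarrow> y \<in> patterns F \<Longrightarrow> z \<in> patterns F \<Longrightarrow> acts_on F (lift F (three_cycle x y z))"
  by (intro acts_on_lift three_cycle_permutes)

lemma acts_on_lift_transpose:
  "x \<in> patterns F \<Longrightarrow> y \<in> patterns F \<Longrightarrow> acts_on F (lift F (transpose x y))"
  by (intro acts_on_lift permutes_swap_id)

lemma ex_not_in_list:
  assumes "finite A" "length xs < card A"
  obtains a where "a \<in> A" "a \<notin> set xs"
proof -
  have "card (set xs) < card A" using card_length[of xs] assms(2) by linarith
  then have "\<not> A \<subseteq> set xs" using card_mono[of "set xs" A] by auto
  then show thesis using that by blast
qed

text \<open>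
  Disjoint conditions add up: this makes it possible to count how many single-pattern controls a
  gate decomposes into, which is where the parity of the alphabet enters.
\<close>

lemma ctrl_Un:
  assumes g: "acts_on R g" and dis: "C \<inter> R = {}" and "A \<inter> B = {}"
  shows "ctrl (\<lambda>t. restrict t C \<in> A \<union> B) g =
    ctrl (\<lambda>t. restrict t C \<in> A) g \<circ> ctrl (\<lambda>t. restrict t C \<in> B) g"
proof -
  have "restrict (fst (g y)) C = restrict (fst y) C" for y
  proof
    fix u show "restrict (fst (g y)) C u = restrict (fst y) C u"
      using acts_on_outside[OF g, of u y] dis by (auto simp: restrict_def)
  qed
  then show ?thesis using assms(3) by (intro ext) (auto simp: ctrl_def)
qed

lemma ctrl_transpose_eq_lift:
  assumes dis: "C \<inter> R = {}" and p: "p \<in> patterns R" "p' \<in> patterns R" "p \<noteq> p'"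
    and s: "s \<in> C \<rightarrow>\<^sub>E UNIV"
  obtains a b where "a \<in> patterns (R \<union> C)" "b \<in> patterns (R \<union> C)" "a \<noteq> b"
    "ctrl (\<lambda>t. restrict t C \<in> {s}) (lift R (transpose p p')) = lift (R \<union> C) (transpose a b)"
proof -
  \<comment> \<open>The pattern on \<open>R \<union> C\<close> that extends one on \<open>R\<close> by \<open>s\<close>.\<close>
  let ?e = "\<lambda>r. (override_on (fst r) s C, snd r) :: ('a \<Rightarrow> 'b) \<times> 'c"
  have e: "?e r \<in> patterns (R \<union> C)" "window R (?e r) = r" if "r \<in> patterns R" for r
  proof -
    show "?e r \<in> patterns (R \<union> C)"
      using that s by (auto simp: patterns_def override_on_def PiE_def extensional_def)
    have "window R (?e r) = window R r" using dis by (auto simp: window_eq_iff override_on_def)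
    then show "window R (?e r) = r" using that by simp
  qed
  have eqC: "R \<union> C - R = C" using dis by auto
  have "lift (R \<union> C) (transpose (?e p) (?e p')) =
      ctrl (\<lambda>t. \<forall>u\<in>C. t u = fst (?e p) u) (lift R (transpose (window R (?e p)) (window R (?e p'))))"
    using lift_transpose_eq_ctrl[of R "R \<union> C" "?e p" "?e p'"] e p unfolding eqC by simp
  also have "(\<lambda>t. \<forall>u\<in>C. t u = fst (?e p) u) = (\<lambda>t. restrict t C \<in> {s})"
    using s by (auto simp: fun_eq_iff PiE_def extensional_def)
  finally have "ctrl (\<lambda>t. restrict t C \<in> {s}) (lift R (transpose p p')) =
      lift (R \<union> C) (transpose (?e p) (?e p'))" using e(2) p by simp
  moreover have "?e p \<noteq> ?e p'" using e(2) p by metis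
  ultimately show thesis using e(1) p that by blast
qed

section \<open>Gates on four cells generate all gates on finitely many cells\<close>

text \<open>
  Four is three plus one: over an alphabet with at least two letters, three cells have at least
  \<open>2 ^ 3\<close> patterns, hence the five that writing a 3-cycle as a commutator of 3-cycles takes, and
  the fourth cell carries one control. Infinitely many cells make sure that a set of cells can always be
  enlarged. The inverses in the commutators are again 3-cycles, so closure under composition is enough.
\<close>

locale gate_set =
  fixes G :: "('c, 'a::finite, 'q::finite) gate set"
  assumes closed: "g \<in> G \<Longrightarrow> h \<in> G \<Longrightarrow> g \<circ> h \<in> G"
    and small: "finite F \<Longrightarrow> card F \<le> 4 \<Longrightarrow> acts_on F g \<Longrightarrow> g \<in> G"
    and infinite_cells: "infinite (UNIV :: 'c set)"
begin

lemma id_in: "id \<in> G"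
  by (rule small[of "{}"]) (simp_all add: acts_on_id)

context
  assumes two: "CARD('a) \<ge> 2"
begin

lemma card_patterns_ge: "finite R \<Longrightarrow> card R = r \<Longrightarrow> card (patterns R :: (('c \<Rightarrow> 'a) \<times> 'q) set) \<ge> 2 ^ r"
  using power_mono[OF two, of r] mult_le_mono[of "2 ^ r" "CARD('a) ^ r" 1 "CARD('q)"]
  by (simp add: card_patterns Suc_leI)

text \<open>
  Write the 3-cycle as a commutator, and put the new control \<open>a\<close> on one factor and the controls
  \<open>C\<close> on the other. The first factor then touches four cells, and the second is covered by the
  induction hypothesis, whatever the size of \<open>C\<close>.
\<close>

lemma controlled_three_cycle:
  assumes "finite C" and R: "finite R" "card R = 3" and "C \<inter> R = {}"
    and "x \<in> patterns R" "y \<in> patterns R" "z \<in> patterns R" "distinct [x, y, z]"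
  shows "ctrl (\<lambda>t. \<forall>c\<in>C. t c = u c) (lift R (three_cycle x y z)) \<in> G"
  using assms(1,4-)
proof (induction C arbitrary: x y z rule: finite_induct)
  case empty
  then have "acts_on R (lift R (three_cycle x y z))" using acts_on_lift_three_cycle by blast
  then have "lift R (three_cycle x y z) \<in> G" using R by (intro small[of R]) auto
  then show ?case by simp
next
  case (insert a C)
  note xyz = insert.prems(2-4)
  have many: "finite (patterns R :: (('c \<Rightarrow> 'a) \<times> 'q) set)" "card (patterns R :: (('c \<Rightarrow> 'a) \<times> 'q) set) \<ge> 8"
    using R card_patterns_ge[of R 3] by simp_all
  obtain v where v: "v \<in> patterns R" "v \<notin> set [x, y, z]"
    using ex_not_in_list[of "patterns R" "[x, y, z]"] many by auto
  obtain w where w: "w \<in> patterns R" "w \<notin> set [x, y, z, v]"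
    using ex_not_in_list[of "patterns R" "[x, y, z, v]"] many by auto
  \<comment> \<open>\<open>v\<close> and \<open>w\<close> are the two auxiliary points of the commutator.\<close>
  let ?P = "\<lambda>t. \<forall>c\<in>C. t c = u c" and ?Q = "\<lambda>t. t a = u a"
  let ?U = "lift R (three_cycle x y v)" and ?U' = "lift R (three_cycle v y x)"
  let ?V = "lift R (three_cycle x z w)" and ?V' = "lift R (three_cycle w z x)"
  have acts: "acts_on R ?U" "acts_on R ?U'" "acts_on R ?V" "acts_on R ?V'"
    using xyz v w by (simp_all add: acts_on_lift_three_cycle)
  have pi: "three_cycle p q r \<in> patterns R \<rightarrow> patterns R"
    if "p \<in> patterns R" "q \<in> patterns R" "r \<in> patterns R" for p q r :: "('c \<Rightarrow> 'a) \<times> 'q"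
    using permutes_Pi[OF three_cycle_permutes] that .
  have inv: "?U \<circ> ?U' = id" "?V \<circ> ?V' = id"
    using xyz v w by (simp_all add: lift_comp pi three_cycle_inverse)
  have disP: "C \<inter> R = {}" and disQ: "{a} \<inter> R = {}" using insert.prems(1) by auto
  have presP: "?P (fst (g s)) = ?P (fst s)" if "acts_on R g" for g :: "('c, 'a, 'q) gate" and s
    by (rule acts_on_preserves_disjoint[OF that disP]) auto
  have presQ: "?Q (fst (g s)) = ?Q (fst s)" if "acts_on R g" for g :: "('c, 'a, 'q) gate" and s
    by (rule acts_on_preserves_disjoint[OF that disQ, where P = ?Q]) auto
  have "three_cycle x y z =
      three_cycle x y v \<circ> three_cycle x z w \<circ> three_cycle v y x \<circ> three_cycle w z x"
    using v w insert.prems(5) by (intro three_cycle_commutator) auto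
  then have "lift R (three_cycle x y z) = ?U \<circ> ?V \<circ> ?U' \<circ> ?V'"
    using xyz v w by (simp add: lift_comp pi)
  moreover have "ctrl ?P ?U \<circ> ctrl ?Q ?V \<circ> ctrl ?P ?U' \<circ> ctrl ?Q ?V' =
      ctrl (\<lambda>t. ?P t \<and> ?Q t) (?U \<circ> ?V \<circ> ?U' \<circ> ?V')"
    by (intro ctrl_commutator inv presP presQ acts)
  ultimately have eq: "ctrl (\<lambda>t. \<forall>c\<in>insert a C. t c = u c) (lift R (three_cycle x y z)) =
      ctrl ?P ?U \<circ> ctrl ?Q ?V \<circ> ctrl ?P ?U' \<circ> ctrl ?Q ?V'"
    by (simp add: conj_commute)
  have "ctrl ?P ?U \<in> G" "ctrl ?P ?U' \<in> G"
    using xyz v w insert.prems(5) disP by (auto intro!: insert.IH)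
  moreover have "ctrl ?Q g \<in> G" if "acts_on R g" for g
  proof (rule small)
    show "acts_on (R \<union> {a}) (ctrl ?Q g)" by (rule acts_on_ctrl[OF that disQ]) auto
    show "card (R \<union> {a}) \<le> 4" using R card_insert_le_m1[of 4 R a] by simp
  qed (use R in simp)
  ultimately show ?case unfolding eq using acts by (intro closed) auto
qed

text \<open>
  Three consecutive adjacent patterns differ in at most two cells, so three cells \<open>R\<close> contain all
  differences and the rest of \<open>F\<close> acts as a control.
\<close>

lemma lift_three_cycle_path:
  assumes F: "finite F" "card F \<ge> 3" and e: "adjacent F x y" "adjacent F y z" and "x \<noteq> z"
  shows "lift F (three_cycle x y z) \<in> G"
proof -
  note pts = e[unfolded adjacent_def]
  have xyz: "x \<in> patterns F" "y \<in> patterns F" "z \<in> patterns F" using pts by auto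
  obtain c c' where c: "\<And>u. u \<noteq> c \<Longrightarrow> fst x u = fst y u" "\<And>u. u \<noteq> c' \<Longrightarrow> fst y u = fst z u"
    using pts by auto
  have "card (F \<inter> {c, c'}) \<le> card {c, c'}" by (intro card_mono) auto
  also have "\<dots> \<le> 3" by (simp add: card_insert_if)
  finally have "\<exists>R. F \<inter> {c, c'} \<subseteq> R \<and> R \<subseteq> F \<and> card R = 3"
    using F by (intro exists_subset_between) auto
  then obtain R where R: "F \<inter> {c, c'} \<subseteq> R" "R \<subseteq> F" "card R = 3" by blast
  have finR: "finite R" using R(2) F(1) finite_subset by blast
  have ag: "fst x u = fst y u" "fst y u = fst z u" if "u \<in> F - R" for u
    using that c R(1) by auto
  have win: "window R p \<noteq> window R q"
    if "p \<in> patterns F" "q \<in> patterns F" "p \<noteq> q" "\<And>u. u \<in> F - R \<Longrightarrow> fst p u = fst q u"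
    for p q :: "('c \<Rightarrow> 'a) \<times> 'q"
  proof
    assume "window R p = window R q"
    then have "window F p = window F q" using that(4) by (auto simp: window_eq_iff)
    then show False using that(1-3) by simp
  qed
  have dist: "distinct [window R x, window R y, window R z]"
    using win xyz ag pts \<open>x \<noteq> z\<close> by auto
  let ?P = "\<lambda>t. \<forall>u\<in>F - R. t u = fst x u"
  let ?x = "window R x" and ?y = "window R y" and ?z = "window R z"
  have P': "(\<lambda>t. \<forall>u\<in>F - R. t u = fst y u) = ?P" using ag(1) by auto
  have "lift F (three_cycle x y z) =
      ctrl ?P (lift R (transpose ?x ?y)) \<circ> ctrl ?P (lift R (transpose ?y ?z))"
    using lift_transpose_eq_ctrl[OF R(2) xyz(1,2) ag(1)] lift_transpose_eq_ctrl[OF R(2) xyz(2,3) ag(2)]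
    by (simp add: lift_three_cycle xyz P')
  also have "\<dots> = ctrl ?P (lift R (transpose ?x ?y) \<circ> lift R (transpose ?y ?z))"
    by (rule ctrl_comp, rule acts_on_preserves_disjoint[where C = "F - R" and R = R])
      (auto intro: acts_on_lift_transpose)
  also have "\<dots> = ctrl ?P (lift R (three_cycle ?x ?y ?z))" by (simp add: lift_three_cycle)
  also have "\<dots> \<in> G" using F finR R(3) dist by (intro controlled_three_cycle) auto
  finally show ?thesis .
qed

lemma lift_transposition_pair:
  assumes F: "finite F" "card F \<ge> 3"
    and pts: "x \<in> patterns F" "y \<in> patterns F" "u \<in> patterns F" "v \<in> patterns F" "x \<noteq> y" "u \<noteq> v"
  shows "lift F (transpose x y \<circ> transpose u v) \<in> G"
proof -
  let ?K = "\<lambda>g. g permutes patterns F \<and> lift F g \<in> G"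
  have "?K (transpose x y \<circ> transpose u v)"
  proof (rule transposition_pairs_from_edges[where E = "adjacent F" and A = "patterns F" and K = ?K, OF _ _ _ _ _ _ pts])
    show "?K (f \<circ> g)" if "?K f" "?K g" for f g
      using that closed[of "lift F f" "lift F g"] by (simp add: lift_comp permutes_Pi permutes_compose)
    show "?K id" using id_in permutes_id lift_id by metis
    show "?K (transpose p q \<circ> transpose q r)" if "adjacent F p q" "adjacent F q r" "p \<noteq> r" for p q r
      using lift_three_cycle_path[OF F that] three_cycle_permutes[of p "patterns F" q r] that
      by (simp add: three_cycle_def adjacent_def)
  qed (use adjacent_connected[OF F(1)] adjacent_sym adjacentD in blast)+
  then show ?thesis by blast
qed

text \<open>
  Each pattern \<open>s \<in> S\<close> contributes one transposition of patterns on \<open>R \<union> C\<close>; an even number of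
  them can be grouped in pairs.
\<close>

lemma even_controlled_transposition:
  assumes fin: "finite R" "finite C" and dis: "C \<inter> R = {}" and big: "card (R \<union> C) \<ge> 3"
    and p: "p \<in> patterns R" "p' \<in> patterns R" "p \<noteq> p'"
    and S: "S \<subseteq> C \<rightarrow>\<^sub>E UNIV" "even (card S)"
  shows "ctrl (\<lambda>t. restrict t C \<in> S) (lift R (transpose p p')) \<in> G"
proof -
  have finS: "finite S" using S(1) fin(2) by (simp add: finite_subset finite_PiE)
  let ?c = "\<lambda>S. ctrl (\<lambda>t. restrict t C \<in> S) (lift R (transpose p p'))"
  note union = ctrl_Un[OF acts_on_lift_transpose[OF p(1,2)] dis]
  note single = ctrl_transpose_eq_lift[OF dis p]
  have pair: "?c {s, s'} \<in> G" if ss: "s \<in> C \<rightarrow>\<^sub>E UNIV" "s' \<in> C \<rightarrow>\<^sub>E UNIV" "s \<noteq> s'" for s s'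
  proof -
    obtain a b where ab: "a \<in> patterns (R \<union> C)" "b \<in> patterns (R \<union> C)" "a \<noteq> b"
      "?c {s} = lift (R \<union> C) (transpose a b)" by (rule single[OF ss(1)])
    obtain a' b' where ab': "a' \<in> patterns (R \<union> C)" "b' \<in> patterns (R \<union> C)" "a' \<noteq> b'"
      "?c {s'} = lift (R \<union> C) (transpose a' b')" by (rule single[OF ss(2)])
    have "?c {s, s'} = lift (R \<union> C) (transpose a b \<circ> transpose a' b')"
      using union[of "{s}" "{s'}"] ss(3) ab ab' by (simp add: lift_comp transpose_Pi insert_commute)
    then show ?thesis using lift_transposition_pair[of "R \<union> C"] fin big ab ab' by simp
  qed
  show ?thesis using finS S
  proof (induction "card S" arbitrary: S rule: less_induct)
    case less
    show ?case
    proof (cases "S = {}")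
      case True
      have "?c {} = id" by (simp add: ctrl_def fun_eq_iff)
      then show ?thesis using True id_in by simp
    next
      case False
      then obtain s where s: "s \<in> S" by blast
      have "S \<noteq> {s}" using less.prems(3) by auto
      then obtain s' where s': "s' \<in> S" "s \<noteq> s'" using s by blast
      let ?S' = "S - {s, s'}"
      have "card S = card ?S' + 2"
        using less.prems(1) s s' card_Diff_subset[of "{s, s'}" S] card_mono[of S "{s, s'}"] by simp
      then have "?c ?S' \<in> G" using less by (intro less.hyps) auto
      moreover have "?c {s, s'} \<in> G" using pair s s' less.prems(2) by blast
      moreover have "?c S = ?c {s, s'} \<circ> ?c ?S'"
        using union[of "{s, s'}" ?S'] s s' by (simp add: insert_absorb)
      ultimately show ?thesis using closed by simp
    qed
  qed
qed

text \<open>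
  A single transposition is an odd permutation of the patterns on \<open>F\<close>, so pairs alone do not reach
  it. For an alphabet of even size, one further cell \<open>c\<close>, on which the gate does not depend, turns it
  into an even number of transpositions. For an alphabet of odd size, a transposition on four cells
  decomposes into an odd number of transpositions on \<open>F\<close>, and cancelling all but one of them in
  pairs leaves one transposition on \<open>F\<close>; the others differ from it by a pair.
\<close>

lemma lift_transposition:
  assumes F: "finite F" "card F \<ge> 4" and pts: "x \<in> patterns F" "y \<in> patterns F"
  shows "lift F (transpose x y) \<in> G"
proof (cases "x = y")
  case True
  then show ?thesis using id_in by simp
next
  case xy: False
  show ?thesis
  proof (cases "even (CARD('a))")
    case True
    obtain c where c: "c \<notin> F" using infinite_cells F(1) ex_new_if_finite by blast
    \<comment> \<open>All values of the new cell: the condition is vacuous, yet splits the gate into evenly many parts.\<close>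
    let ?S = "{c} \<rightarrow>\<^sub>E (UNIV :: 'a set)"
    have "even (card ?S)" using True by (simp add: card_PiE)
    then have "ctrl (\<lambda>t. restrict t {c} \<in> ?S) (lift F (transpose x y)) \<in> G"
      using c F pts xy by (intro even_controlled_transposition) auto
    then show ?thesis by simp
  next
    case odd: False
    obtain R where R: "R \<subseteq> F" "card R = 4" "finite R" using obtain_subset_with_card_n[OF F(2)] by metis
    have many: "card (patterns R :: (('c \<Rightarrow> 'a) \<times> 'q) set) \<ge> 16" using card_patterns_ge[of R 4] R by simp
    obtain p :: "('c \<Rightarrow> 'a) \<times> 'q" where p: "p \<in> patterns R"
      using ex_not_in_list[of "patterns R :: (('c \<Rightarrow> 'a) \<times> 'q) set" "[]"] many R by auto
    obtain p' where "p' \<in> patterns R" "p' \<notin> set [p]"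
      using ex_not_in_list[of "patterns R" "[p]"] many R by auto
    then have p': "p' \<in> patterns R" "p \<noteq> p'" by auto
    let ?C = "F - R" and ?all = "(F - R) \<rightarrow>\<^sub>E (UNIV :: 'a set)"
    \<comment> \<open>The pattern whose transposition survives when all other controlled parts are cancelled.\<close>
    obtain s where s: "s \<in> ?all" by (metis all_not_in_conv PiE_eq_empty_iff UNIV_not_empty)
    have "finite ?all" "odd (card ?all)" using odd F by (simp_all add: card_PiE finite_PiE)
    then have "even (card (?all - {s}))" using s by (simp add: card_Diff_singleton)
    then have rest: "ctrl (\<lambda>t. restrict t ?C \<in> ?all - {s}) (lift R (transpose p p')) \<in> G"
      using R p p' F by (intro even_controlled_transposition) (auto simp: Un_absorb1)
    have base: "lift R (transpose p p') \<in> G"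
      using small[of R] R p p' by (simp add: acts_on_lift_transpose)
    have un: "R \<union> ?C = F" using R by auto
    obtain a b where ab: "a \<in> patterns F" "b \<in> patterns F" "a \<noteq> b"
      "ctrl (\<lambda>t. restrict t ?C \<in> {s}) (lift R (transpose p p')) = lift F (transpose a b)"
      using ctrl_transpose_eq_lift[of ?C R p p' s] p p' s unfolding un by blast
    let ?g = "lift R (transpose p p')" and ?P = "\<lambda>t. restrict t ?C \<in> ?all - {s}"
    have acts: "acts_on R ?g" using p p' by (simp add: acts_on_lift_transpose)
    have "?g \<circ> ?g = id" using p p' by (simp add: lift_comp transpose_Pi)
    moreover have "?P (fst (?g y)) = ?P (fst y)" for y
      by (rule acts_on_preserves_disjoint[OF acts, of ?C]) (auto simp: restrict_def)
    ultimately have invol: "ctrl ?P ?g \<circ> ctrl ?P ?g = id"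
      by (simp add: ctrl_comp) (simp add: ctrl_def fun_eq_iff)
    have all: "(\<lambda>t. restrict t ?C \<in> (?all - {s}) \<union> {s}) = (\<lambda>t. True)" using s by auto
    have "ctrl (\<lambda>t. restrict t ?C \<in> (?all - {s}) \<union> {s}) ?g =
        ctrl ?P ?g \<circ> ctrl (\<lambda>t. restrict t ?C \<in> {s}) ?g"
      by (rule ctrl_Un[OF acts]) auto
    then have "?g = ctrl ?P ?g \<circ> lift F (transpose a b)" by (simp only: ab(4) all ctrl_True)
    then have "ctrl ?P ?g \<circ> ?g = (ctrl ?P ?g \<circ> ctrl ?P ?g) \<circ> lift F (transpose a b)"
      unfolding comp_assoc by (rule arg_cong)
    then have "ctrl ?P ?g \<circ> ?g = lift F (transpose a b)" unfolding invol by simp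
    then have "lift F (transpose a b) \<in> G" using closed[OF rest base] by simp
    moreover have "lift F (transpose a b \<circ> transpose x y) \<in> G"
      using F pts ab xy by (intro lift_transposition_pair) auto
    moreover have "lift F (transpose x y) =
        lift F (transpose a b) \<circ> lift F (transpose a b \<circ> transpose x y)"
    proof -
      have "lift F (transpose a b) \<circ> lift F (transpose a b \<circ> transpose x y) =
          lift F (transpose a b \<circ> (transpose a b \<circ> transpose x y))"
        using ab pts by (intro lift_comp permutes_Pi permutes_compose permutes_swap_id)
      also have "transpose a b \<circ> (transpose a b \<circ> transpose x y) = transpose x y"
        by (simp add: fun_eq_iff)
      finally show ?thesis by (rule sym)
    qed
    ultimately show ?thesis using closed by metis
  qed
qed

end

text \<open>
  For a one-letter alphabet there is only one tape, so every gate acts on the state alone and is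
  small. Otherwise the claim follows from transpositions generating all permutations.
\<close>

lemma finite_gate_in:
  assumes "finite F" and g: "acts_on F g"
  shows "g \<in> G"
proof (cases "CARD('a) = 1")
  case True
  then have "x = y" for x y :: "'c \<Rightarrow> 'a"
    by (metis card_1_singletonE ext UNIV_I singletonD)
  then have "acts_on {} g" using g unfolding acts_on_def by (metis)
  then show ?thesis by (intro small[of "{}"]) auto
next
  case False
  then have two: "CARD('a) \<ge> 2" using zero_less_card_finite[where 'a = 'a] by linarith
  obtain E :: "'c set" where E: "finite E" "card E = 4"
    using infinite_arbitrarily_large[OF infinite_cells] by blast
  let ?F = "F \<union> E"
  have F: "finite ?F" "card ?F \<ge> 4" using assms(1) E card_mono[of ?F E] by auto
  obtain h where h: "h permutes patterns ?F" "g = lift ?F h"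
    using acts_on_imp_lift[OF acts_on_mono[OF g] F(1)] by blast
  have "h permutes patterns ?F \<and> lift ?F h \<in> G"
    using h(1) finite_patterns[OF F(1)]
  proof (induction rule: permutes_induct)
    case id
    then show ?case using id_in permutes_id lift_id by metis
  next
    case (swap a b p)
    then have "lift ?F (transpose a b \<circ> p) = lift ?F (transpose a b) \<circ> lift ?F p"
      by (simp add: lift_comp permutes_Pi)
    then show ?case
      using swap closed lift_transposition[OF two F] permutes_compose[OF _ permutes_swap_id] by metis
  qed
  then show ?thesis using h by simp
qed

end

section \<open>Moving cells together\<close>

definition cell_swap :: "'c \<Rightarrow> 'c \<Rightarrow> ('c, 'a, 'q) gate"
  where "cell_swap u v y = (fst y \<circ> transpose u v, snd y)"

lemma cell_swap_self [simp]: "cell_swap u u = id"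
  by (simp add: cell_swap_def fun_eq_iff)

lemma cell_swap_commute: "cell_swap u v = cell_swap v u"
  by (simp add: cell_swap_def fun_eq_iff transpose_commute)

lemma cell_swap_cell_swap: "cell_swap u v \<circ> cell_swap u v = id"
  by (simp add: cell_swap_def fun_eq_iff)

lemma cell_swap_triple:
  assumes "u \<noteq> w" "v \<noteq> w"
  shows "cell_swap u v \<circ> cell_swap v w \<circ> cell_swap u v = cell_swap u w"
proof -
  have "transpose u v (transpose v w (transpose u v c)) = transpose u w c" for c
    using fun_cong[OF transpose_comp_triple[OF assms], of c] by (simp only: comp_apply)
  then show ?thesis by (intro ext) (simp only: cell_swap_def comp_def fst_conv snd_conv)
qed

lemma bij_cell_swap: "bij (cell_swap u v)"
  by (rule o_bij[OF cell_swap_cell_swap cell_swap_cell_swap])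

lemma acts_on_cell_swap: "acts_on {u, v} (cell_swap u v)"
  using bij_cell_swap by (auto simp: acts_on_def cell_swap_def transpose_def)

lemma acts_on_conj_cell_swap:
  assumes g: "acts_on F g"
  shows "acts_on (transpose u v ` F) (cell_swap u v \<circ> g \<circ> cell_swap u v)"
proof -
  let ?t = "transpose u v"
  have conj_apply: "(cell_swap u v \<circ> g \<circ> cell_swap u v) (x, q) =
      (fst (g (x \<circ> ?t, q)) \<circ> ?t, snd (g (x \<circ> ?t, q)))" for x q
    by (simp add: cell_swap_def)
  show ?thesis unfolding acts_on_def conj_apply fst_conv snd_conv
  proof (intro conjI allI impI ballI)
    show "bij (cell_swap u v \<circ> g \<circ> cell_swap u v)"
      using g bij_cell_swap by (auto simp: acts_on_def intro!: bij_comp)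
  next
    fix x q w assume "w \<notin> ?t ` F"
    then have "?t w \<notin> F" by (metis imageI transpose_involutory)
    then show "(fst (g (x \<circ> ?t, q)) \<circ> ?t) w = x w"
      using acts_on_outside[OF g, of "?t w" "(x \<circ> ?t, q)"] by simp
  next
    fix x y :: "'a \<Rightarrow> 'b" and q :: 'c assume "\<forall>w\<in>?t ` F. x w = y w"
    then have ag: "\<forall>w\<in>F. (x \<circ> ?t) w = (y \<circ> ?t) w" by simp
    show "snd (g (x \<circ> ?t, q)) = snd (g (y \<circ> ?t, q))" by (rule acts_on_agree(1)[OF g ag])
    fix w assume "w \<in> ?t ` F"
    then have "?t w \<in> F" by auto
    then have "fst (g (x \<circ> ?t, q)) (?t w) = fst (g (y \<circ> ?t, q)) (?t w)"
      by (rule acts_on_agree(2)[OF g ag])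
    then show "(fst (g (x \<circ> ?t, q)) \<circ> ?t) w = (fst (g (y \<circ> ?t, q)) \<circ> ?t) w"
      by (simp only: comp_apply)
  qed
qed

text \<open>
  Conjugating with a swap of a cell \<open>u\<close> of \<open>F\<close> outside \<open>F0\<close> and a free cell of \<open>F0\<close> brings one more
  cell into \<open>F0\<close>. Hence only the number of cells matters, not where they are.
\<close>

lemma acts_on_relocate:
  fixes g :: "('c, 'a, 'q) gate"
  assumes closed: "\<And>g h. g \<in> G \<Longrightarrow> h \<in> G \<Longrightarrow> g \<circ> h \<in> G"
    and swaps: "\<And>u v. cell_swap u v \<in> G"
    and base: "\<And>g. acts_on F0 g \<Longrightarrow> g \<in> G" and "finite F0"
    and F: "finite F" "card F \<le> card F0" "acts_on F g"
  shows "g \<in> G"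
  using F
proof (induction "card (F - F0)" arbitrary: F g)
  case 0
  then have "F \<subseteq> F0" by simp
  then show ?case using base acts_on_mono 0 by blast
next
  case (Suc n)
  then obtain u where u: "u \<in> F" "u \<notin> F0" by (metis Diff_iff card_eq_0_iff ex_in_conv nat.distinct(1))
  have "\<not> F0 \<subseteq> F"
    using u Suc.prems psubset_card_mono[of F F0] by auto
  then obtain v where v: "v \<in> F0" "v \<notin> F" by blast
  let ?s = "cell_swap u v :: ('c, 'a, 'q) gate" and ?F = "transpose u v ` F"
  have F': "?F = insert v (F - {u})" using u v by (force simp: transpose_def image_iff)
  have "?F - F0 = (F - F0) - {u}" using v unfolding F' by auto
  then have "n = card (?F - F0)" using u Suc.hyps(2) Suc.prems(1) by simp
  moreover have "card ?F \<le> card F0"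
    using card_image_le[OF Suc.prems(1)] Suc.prems(2) le_trans by blast
  ultimately have "?s \<circ> g \<circ> ?s \<in> G"
    using Suc.prems acts_on_conj_cell_swap by (intro Suc.hyps(1)[of ?F]) auto
  then have "?s \<circ> (?s \<circ> g \<circ> ?s) \<circ> ?s \<in> G" using closed swaps by blast
  moreover have "?s \<circ> (?s \<circ> g \<circ> ?s) \<circ> ?s = g"
  proof -
    have "?s (?s y) = y" for y using cell_swap_cell_swap[of u v] by (metis comp_apply id_apply)
    then show ?thesis by (intro ext) (simp only: comp_apply)
  qed
  ultimately show ?case by simp
qed

lemma int_vec_induct [case_names axis add uminus]:
  fixes w :: "int ^ 'd::finite"
  assumes axis: "\<And>i. P (axis i 1)" and add: "\<And>a b. P a \<Longrightarrow> P b \<Longrightarrow> P (a + b)"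
    and uminus: "\<And>a. P a \<Longrightarrow> P (- a)"
  shows "P w"
proof -
  \<comment> \<open>Any axis serves here, and there is one because types are nonempty.\<close>
  have zero: "P 0" using add[OF axis[of undefined] uminus[OF axis[of undefined]]] by simp
  have scaled: "P (axis i k)" for i :: 'd and k :: int
  proof (induction k rule: int_induct[where k = 0])
    case base
    then show ?case using zero by (simp add: axis_def zero_vec_def)
  next
    case (step1 k)
    have "axis i (k + 1) = axis i k + (axis i 1 :: int ^ 'd)" by (simp add: axis_def vec_eq_iff)
    then show ?case using add axis step1 by metis
  next
    case (step2 k)
    have "axis i (k - 1) = axis i k + - (axis i 1 :: int ^ 'd)" by (simp add: axis_def vec_eq_iff)
    then show ?case using add axis uminus step2 by metis
  qed
  have "P (\<Sum>i\<in>I. axis i (w $ i))" if "finite I" for I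
    using that by (induction I rule: finite_induct) (auto intro: zero add scaled)
  moreover have "(\<Sum>i\<in>UNIV. axis i (w $ i)) = w"
    by (simp add: vec_eq_iff axis_def sum.delta)
  ultimately show ?thesis by (metis finite)
qed

text \<open>
  The relation ``the swap of \<open>u\<close> and \<open>v\<close> is in \<open>G\<close>'' is an equivalence relation, by conjugation,
  so it suffices that it relates neighbours in the grid.
\<close>

lemma cell_swap_from_neighbours:
  fixes G :: "(int ^ 'd::finite, 'a, 'q) gate set"
  assumes closed: "\<And>g h. g \<in> G \<Longrightarrow> h \<in> G \<Longrightarrow> g \<circ> h \<in> G" and id: "id \<in> G"
    and neighbours: "\<And>u i. cell_swap u (u + axis i 1) \<in> G"
  shows "cell_swap u v \<in> G"
proof -
  have trans: "cell_swap u w \<in> G" if "cell_swap u v \<in> G" "cell_swap v w \<in> G" for u v w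
  proof (cases "u = w \<or> v = w")
    case True
    then show ?thesis using that id by auto
  next
    case False
    then have "cell_swap u w = cell_swap u v \<circ> cell_swap v w \<circ> cell_swap u v"
      using cell_swap_triple[of u w v] by metis
    then show ?thesis using that closed by metis
  qed
  have "\<forall>u. cell_swap u (u + w) \<in> G" for w
  proof (induction w rule: int_vec_induct)
    case (axis i)
    then show ?case using neighbours by blast
  next
    case (add a b)
    then show ?case using trans by (metis add.assoc)
  next
    case (uminus a)
    then show ?case by (metis add.commute cell_swap_commute minus_add_cancel)
  qed
  then have "cell_swap u (u + (v - u)) \<in> G" by blast
  then show ?thesis by simp
qed

section \<open>Machines as bijections of configurations\<close>

text \<open>
  All bijections of configurations form a group for trivial reasons, and inverses of reversible
  machines are the same there as in \<open>RTM\<close>. Generated subgroups can therefore be computed in this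
  group, where closure under composition and inverses is immediate.
\<close>

definition bijections :: "('y \<Rightarrow> 'y) monoid"
  where "bijections = \<lparr>carrier = {f. bij f}, monoid.mult = (\<circ>), one = id\<rparr>"

lemma bijections_simps [simp]:
  "carrier bijections = {f. bij f}" "f \<otimes>\<^bsub>bijections\<^esub> g = f \<circ> g" "\<one>\<^bsub>bijections\<^esub> = id"
  by (simp_all add: bijections_def)

lemma group_bijections: "group bijections"
proof (rule groupI)
  fix f :: "'y \<Rightarrow> 'y" assume f: "f \<in> carrier bijections"
  then have "Hilbert_Choice.inv f \<circ> f = id" by (simp add: bij_is_inj)
  moreover have "bij (Hilbert_Choice.inv f)" using f by (simp add: bij_imp_bij_inv)
  ultimately show "\<exists>g\<in>carrier bijections. g \<otimes>\<^bsub>bijections\<^esub> f = \<one>\<^bsub>bijections\<^esub>" by auto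
qed (auto simp: bij_comp comp_assoc)

lemma m_inv_RTM: "T \<in> carrier RTM \<Longrightarrow> inv\<^bsub>RTM\<^esub> T = inv\<^bsub>bijections\<^esub> T"
proof -
  assume "T \<in> carrier RTM"
  then have T: "reversible T" by (simp add: RTM_def)
  then obtain T' where T': "turing_machine T'" "T \<circ> T' = id" "T' \<circ> T = id"
    unfolding reversible_def by blast
  have rev: "reversible T'" using T T' unfolding reversible_def by blast
  have "inv\<^bsub>RTM\<^esub> T = T'"
    unfolding m_inv_def RTM_def using rev T' by (auto intro!: the_equality) (metis comp_assoc comp_id id_comp)
  moreover have "inv\<^bsub>bijections\<^esub> T = T'"
    using T' o_bij[of T T'] o_bij[of T' T] by (intro group.inv_equality[OF group_bijections]) auto
  ultimately show ?thesis by simp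
qed

lemma RTM_subset_bijections: "carrier RTM \<subseteq> carrier bijections"
  unfolding RTM_def reversible_def using o_bij by auto

lemma one_RTM: "\<one>\<^bsub>RTM\<^esub> = \<one>\<^bsub>bijections\<^esub>"
  by (simp add: RTM_def)

lemma mult_RTM: "g \<otimes>\<^bsub>RTM\<^esub> h = g \<otimes>\<^bsub>bijections\<^esub> h"
  by (simp add: RTM_def)

lemma generate_RTM: "H \<subseteq> carrier RTM \<Longrightarrow> generate RTM H = generate bijections H"
proof (intro equalityI subsetI)
  fix T assume H: "H \<subseteq> carrier RTM" and "T \<in> generate RTM H"
  from this(2) show "T \<in> generate bijections H"
  proof induction
    case one
    then show ?case using generate.one[of bijections] unfolding one_RTM .
  next
    case (inv h)
    then have h: "h \<in> carrier RTM" using H by blast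
    from generate.inv[OF inv, of bijections] show ?case unfolding m_inv_RTM[OF h] .
  next
    case (eng h1 h2)
    show ?case unfolding mult_RTM using eng.IH by (rule generate.eng)
  qed (rule generate.incl)
next
  fix T assume H: "H \<subseteq> carrier RTM" and "T \<in> generate bijections H"
  from this(2) show "T \<in> generate RTM H"
  proof induction
    case one
    then show ?case using generate.one[of RTM] unfolding one_RTM .
  next
    case (inv h)
    then have h: "h \<in> carrier RTM" using H by blast
    from generate.inv[OF inv, of RTM] show ?case unfolding m_inv_RTM[OF h] .
  next
    case (eng h1 h2)
    show ?case unfolding mult_RTM[symmetric] using eng.IH by (rule generate.eng)
  qed (rule generate.incl)
qed

lemma shift_shift [simp]: "shift v (shift w x) = shift (v + w) x"
  by (simp add: shift_def fun_eq_iff algebra_simps)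

lemma shift_0 [simp]: "shift 0 x = x"
  by (simp add: shift_def)

lemma head_shift_apply [simp]: "head_shift w (x, q, v) = (x, q, v + w)"
  by (simp add: head_shift_def)

lemma head_shift_comp: "head_shift a \<circ> head_shift b = head_shift (a + b)"
  by (auto simp: head_shift_def fun_eq_iff)

lemma head_shift_0: "head_shift 0 = id"
  by (auto simp: head_shift_def fun_eq_iff)

lemma bij_head_shift: "bij (head_shift w)"
  using o_bij[of "head_shift (- w)" "head_shift w"] by (simp add: head_shift_comp head_shift_0)

lemma m_inv_head_shift: "inv\<^bsub>bijections\<^esub> (head_shift w) = head_shift (- w)"
  by (rule group.inv_equality[OF group_bijections]) (simp_all add: head_shift_comp head_shift_0 bij_head_shift)

lemma head_shift_in_RTM: "head_shift w \<in> carrier RTM"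
proof -
  have "has_local_rule (head_shift a) {} {} (\<lambda>p q. (\<lambda>u. undefined, q, a))" for a
    by (simp add: has_local_rule_def)
  then have "turing_machine (head_shift a)" for a unfolding turing_machine_def by blast
  moreover have "head_shift w \<circ> head_shift (- w) = id" "head_shift (- w) \<circ> head_shift w = id"
    by (simp_all add: head_shift_comp head_shift_0)
  ultimately show ?thesis unfolding RTM_def reversible_def by auto
qed

lemma SHIFT_eq: "SHIFT = range head_shift"
proof
  have "subgroup (range head_shift) bijections"
    by (rule group.subgroupI[OF group_bijections])
      (auto simp: bij_head_shift m_inv_head_shift head_shift_comp)
  then have "generate bijections (range head_shift) \<subseteq> range head_shift"
    by (intro group.generate_subgroup_incl[OF group_bijections]) auto
  then show "SHIFT \<subseteq> range head_shift"
    unfolding SHIFT_def using generate_RTM head_shift_in_RTM by (metis image_subsetI)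
qed (auto simp: SHIFT_def intro: generate.incl)

lemma OB_eq: "OB = bijections\<lparr>carrier := generate bijections (range head_shift \<union> LP)\<rparr>"
proof -
  have "generate RTM (SHIFT \<union> LP) = generate bijections (range head_shift \<union> LP)"
    unfolding SHIFT_eq using head_shift_in_RTM by (intro generate_RTM) (auto simp: LP_def RTM_def)
  then show ?thesis by (simp add: OB_def RTM_def bijections_def)
qed

definition at_head :: "(int ^ 'd::finite, 'a::finite, 'q::finite) gate \<Rightarrow> ('d, 'a, 'q) machine"
  where "at_head g = (\<lambda>(x, q, v). (shift v (fst (g (shift (- v) x, q))), snd (g (shift (- v) x, q)), v))"

lemma at_head_comp: "at_head g \<circ> at_head h = at_head (g \<circ> h)"
  by (auto simp: at_head_def fun_eq_iff)

lemma at_head_id: "at_head id = id"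
  by (auto simp: at_head_def fun_eq_iff)

lemma at_head_local_rule:
  assumes F: "finite F" and g: "acts_on F g"
  shows "has_local_rule (at_head g) F F (\<lambda>p q. (restrict (fst (g (p, q))) F, snd (g (p, q)), 0))"
  unfolding has_local_rule_def
proof (intro conjI allI ballI F)
  fix x :: "('a, 'b) tape" and q :: 'c and v :: "int ^ 'a"
  let ?y = "shift (- v) x"
  have ag: "\<forall>u\<in>F. ?y u = restrict ?y F u" by simp
  have "shift v (fst (g (?y, q))) u =
      (if u - v \<in> F then fst (g (restrict ?y F, q)) (u - v) else x u)" for u
    using acts_on_agree(2)[OF g ag, of "u - v" q] acts_on_outside[OF g, of "u - v" "(?y, q)"]
    by (simp add: shift_def restrict_def)
  moreover have "snd (g (?y, q)) = snd (g (restrict ?y F, q))"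
    using acts_on_agree(1)[OF g ag] by (simp add: restrict_def)
  ultimately show "at_head g (x, q, v) =
      (let (p', q', u') = (restrict (fst (g (restrict ?y F, q))) F, snd (g (restrict ?y F, q)), 0)
       in (\<lambda>u. if u - v \<in> F then p' (u - v) else x u, q', v + u'))"
    by (auto simp: at_head_def fun_eq_iff)
qed auto

lemma at_head_in_LP:
  assumes "finite F" "acts_on F g"
  shows "at_head g \<in> LP"
proof -
  let ?h = "Hilbert_Choice.inv g"
  have h: "acts_on F ?h" using acts_on_inv assms by blast
  have "bij g" using assms by (simp add: acts_on_def)
  then have "g \<circ> ?h = id" "?h \<circ> g = id" by (simp_all add: bij_is_surj bij_is_inj surj_iff[symmetric])
  then have "at_head g \<circ> at_head ?h = id" "at_head ?h \<circ> at_head g = id"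
    by (simp_all add: at_head_comp at_head_id)
  then have "reversible (at_head g)"
    unfolding reversible_def turing_machine_def
    using at_head_local_rule[OF assms] at_head_local_rule[OF assms(1) h] by blast
  then show ?thesis
    unfolding LP_def using at_head_local_rule[OF assms] by fastforce
qed

text \<open>
  Reading off the step at head position \<open>0\<close> gives the gate. It is bijective because the machine is:
  the head does not move, so the configurations with head position \<open>0\<close> are mapped to themselves and
  have all their preimages among themselves.
\<close>

lemma LP_imp_at_head:
  fixes T :: "('d::finite, 'a::finite, 'q::finite) machine"
  assumes "T \<in> LP"
  obtains F g where "finite F" "acts_on F g" "T = at_head g"
proof -
  obtain A B f where T: "reversible T" "has_local_rule T A B f"
    and still: "\<And>p q. p \<in> A \<rightarrow>\<^sub>E UNIV \<Longrightarrow> snd (snd (f p q)) = 0"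
    using assms unfolding LP_def by blast
  have fin: "finite A" "finite B" using T(2) by (simp_all add: has_local_rule_def)
  define r where "r x q = f (restrict x A) q" for x q
  have rule: "T (x, q, v) = (\<lambda>u. if u - v \<in> B then fst (r (shift (- v) x) q) (u - v) else x u,
      fst (snd (r (shift (- v) x) q)), v)" for x q v
    using T(2) still[of "restrict (shift (- v) x) A" q]
    by (auto simp: has_local_rule_def r_def split: prod.splits)
  define g :: "(int ^ 'd, 'a, 'q) gate" where
    "g = (\<lambda>(x, q). (\<lambda>u. if u \<in> B then fst (r x q) u else x u, fst (snd (r x q))))"
  have Tg: "T (x, q, 0) = (fst (g (x, q)), snd (g (x, q)), 0)" for x q
    using rule[of x q 0] by (simp add: g_def cong: if_cong)
  have "T = at_head g"
    by (auto simp: fun_eq_iff rule at_head_def g_def shift_def)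
  moreover have "acts_on (A \<union> B) g"
    unfolding acts_on_def
  proof (intro conjI allI impI)
    have bijT: "bij T" using T(1) RTM_subset_bijections by (auto simp: RTM_def)
    have "inj g"
    proof (rule injI)
      fix y z assume "g y = g z"
      then have "T (fst y, snd y, 0) = T (fst z, snd z, 0)" by (simp add: Tg)
      then have "(fst y, snd y, 0) = (fst z, snd z, 0 :: int ^ 'd)"
        by (rule injD[OF bij_is_inj[OF bijT]])
      then show "y = z" by (simp add: prod_eq_iff)
    qed
    moreover have "surj g"
    proof (rule surjI)
      fix y :: "('d, 'a) tape \<times> 'q"
      let ?c = "Hilbert_Choice.inv T (fst y, snd y, 0)"
      have c: "T ?c = (fst y, snd y, 0)" using bijT by (simp add: bij_is_surj surj_f_inv_f)
      obtain x q v where xqv: "?c = (x, q, v)" by (cases ?c)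
      have "v = 0" using c rule[of x q v] unfolding xqv by simp
      then show "g (fst ?c, fst (snd ?c)) = y" using c Tg unfolding xqv by (simp add: prod_eq_iff)
    qed
    ultimately show "bij g" by (simp add: bij_def)
  next
    fix x q u assume "u \<notin> A \<union> B"
    then show "fst (g (x, q)) u = x u" by (simp add: g_def)
  next
    fix x y :: "('d, 'a) tape" and q assume ag: "\<forall>u\<in>A \<union> B. x u = y u"
    then have "restrict x A = restrict y A" by (auto simp: restrict_def)
    then have "r x q = r y q" by (simp add: r_def)
    then show "snd (g (x, q)) = snd (g (y, q))" "\<forall>u\<in>A \<union> B. fst (g (x, q)) u = fst (g (y, q)) u"
      using ag by (auto simp: g_def)
  qed
  ultimately show thesis using that fin by blast
qed

text \<open>
  Moving the head away, acting, and moving back applies the same gate at a translated place. Thus the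
  swap of the origin with a neighbour yields all swaps of neighbours in that direction.
\<close>

lemma head_shift_conj_cell_swap:
  fixes u :: "int ^ 'd::finite"
  shows "head_shift (- u) \<circ> at_head (cell_swap a b) \<circ> head_shift u = at_head (cell_swap (u + a) (u + b))"
proof -
  have relabel: "transpose a b (c - (v + u)) + (v + u) = transpose (u + a) (u + b) (c - v) + v" for c v
    by (auto simp: transpose_def algebra_simps)
  show ?thesis
  proof (rule ext)
    fix y :: "('d, 'a::finite, 'q::finite) config"
    obtain x q v where y: "y = (x, q, v)" by (cases y)
    show "(head_shift (- u) \<circ> at_head (cell_swap a b) \<circ> head_shift u) y = at_head (cell_swap (u + a) (u + b)) y"
      by (simp add: y at_head_def cell_swap_def shift_def relabel)
  qed
qed

lemma infinite_int_vec: "infinite (UNIV :: (int ^ 'd::finite) set)"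
proof
  let ?f = "\<lambda>k :: int. axis undefined k :: int ^ 'd"
  assume "finite (UNIV :: (int ^ 'd) set)"
  then have "finite (range ?f)" by (rule rev_finite_subset) simp
  moreover have "inj ?f" by (simp add: inj_def axis_eq_axis)
  ultimately have "finite (UNIV :: int set)" by (rule finite_imageD)
  then show False by simp
qed

text \<open>
  The generators are the unit shifts and all gates on one finite set \<open>F0\<close>. It contains the origin and
  its neighbours in the positive axis directions, so that swaps of neighbours are available, and at
  least four cells, so that it has room for every four-cell gate.
\<close>

theorem theorem3p18:
  shows "finitely_generated_group (OB :: ('d::finite, 'a::finite, 'q::finite) machine monoid)"
proof -
  let ?B = "bijections :: ('d, 'a, 'q) machine monoid"
  interpret B: group ?B by (rule group_bijections)
  define X :: "('d, 'a, 'q) machine set" where "X = range head_shift \<union> LP"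
  have "LP \<subseteq> carrier ?B" using RTM_subset_bijections by (auto simp: LP_def RTM_def)
  then have X: "X \<subseteq> carrier ?B" by (auto simp: X_def bij_head_shift)
  obtain E :: "(int ^ 'd) set" where E: "finite E" "card E = 4"
    using infinite_arbitrarily_large[OF infinite_int_vec] by blast
  define F0 where "F0 = insert 0 (range (\<lambda>i. axis i 1)) \<union> E"
  have F0: "finite F0" "card F0 \<ge> 4"
    using E card_mono[of F0 E] by (auto simp: F0_def)
  define S :: "('d, 'a, 'q) machine set" where
    "S = range (\<lambda>i. head_shift (axis i 1)) \<union> at_head ` {g. acts_on F0 g}"
  have "finite {g :: (int ^ 'd, 'a, 'q) gate. acts_on F0 g}" by (rule finite_acts_on[OF F0(1)])
  then have finS: "finite S" by (simp add: S_def)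
  have SX: "S \<subseteq> X" using at_head_in_LP[OF F0(1)] by (auto simp: S_def X_def)
  define H where "H = generate ?B S"
  have H: "subgroup H ?B" unfolding H_def using SX X by (intro B.generate_is_subgroup) auto
  have H_comp: "g \<circ> h \<in> H" if "g \<in> H" "h \<in> H" for g h
    using subgroup.m_closed[OF H that] by simp
  have H_shift: "head_shift w \<in> H" for w
  proof (induction w rule: int_vec_induct)
    case (axis i)
    show ?case unfolding H_def S_def by (intro generate.incl) auto
  next
    case (add a b)
    then show ?case using H_comp head_shift_comp by metis
  next
    case (uminus a)
    then show ?case using subgroup.m_inv_closed[OF H] m_inv_head_shift by metis
  qed
  define G :: "(int ^ 'd, 'a, 'q) gate set" where "G = {g. at_head g \<in> H}"
  have G_comp: "g \<circ> h \<in> G" if "g \<in> G" "h \<in> G" for g h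
    using that H_comp by (simp add: G_def at_head_comp[symmetric])
  have G_F0: "g \<in> G" if "acts_on F0 g" for g
    unfolding G_def H_def S_def using that by (auto intro: generate.incl)
  have G_id: "id \<in> G" using G_F0 acts_on_id by blast
  have G_swap: "cell_swap u v \<in> G" for u v
  proof (rule cell_swap_from_neighbours[OF G_comp G_id])
    fix u :: "int ^ 'd" and i :: 'd
    have "{0, axis i 1} \<subseteq> F0" by (auto simp: F0_def)
    then have "cell_swap 0 (axis i 1) \<in> G" by (intro G_F0 acts_on_mono[OF acts_on_cell_swap])
    then have "at_head (cell_swap 0 (axis i 1)) \<in> H" by (simp add: G_def)
    then have "head_shift (- u) \<circ> at_head (cell_swap 0 (axis i 1)) \<circ> head_shift u \<in> H"
      using H_comp H_shift by blast
    then show "cell_swap u (u + axis i 1) \<in> G"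
      unfolding head_shift_conj_cell_swap by (simp add: G_def)
  qed
  interpret gate_set G
  proof
    show "g \<in> G" if "finite F" "card F \<le> 4" "acts_on F g" for F g
      using acts_on_relocate[OF G_comp G_swap G_F0 F0(1)] that F0(2) by (meson le_trans)
  qed (use G_comp infinite_int_vec in blast)+
  have "X \<subseteq> H"
  proof
    fix T assume "T \<in> X"
    then consider w where "T = head_shift w" | "T \<in> LP" by (auto simp: X_def)
    then show "T \<in> H"
    proof cases
      case 2
      then obtain F g where "finite F" "acts_on F g" "T = at_head g" by (rule LP_imp_at_head)
      then show ?thesis using finite_gate_in by (auto simp: G_def)
    qed (use H_shift in simp)
  qed
  then have gen: "generate ?B X = H"
    using B.generate_subgroup_incl[OF _ H] B.mono_generate[OF SX] by (auto simp: H_def)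
  have OB: "OB = ?B\<lparr>carrier := H\<rparr>" unfolding OB_eq gen[symmetric] X_def ..
  have SH: "S \<subseteq> H" by (auto simp: H_def intro: generate.incl)
  have "group (?B\<lparr>carrier := H\<rparr>)" using H B.subgroup_imp_group by blast
  moreover have "generate (?B\<lparr>carrier := H\<rparr>) S = H"
    using B.generate_consistent[OF SH H] by (simp add: H_def)
  ultimately show ?thesis
    unfolding finitely_generated_group_def OB using finS SH by auto
qed

end
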